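(* Let $(\mathfrak g,\omega)$ be a nilpotent symplectic Lie algebra of dimension less than or equal to six. Then $(\mathfrak g,\omega)$ has a Lagrangian ideal.
   Context: All Lie algebras are finite-dimensional over a fixed field $k$ of characteristic $0$. A symplectic Lie algebra $(\mathfrak g,\omega)$ is a Lie algebra with a non-degenerate alternating form $\omega$ satisfying $\omega([u,v],w)+\omega([w,u],v)+\omega([v,w],u)=0$; it is nilpotent if $\mathfrak g$ is nilpotent. A Lagrangian ideal is an ideal of $\mathfrak g$ equal to its $\omega$-orthogonal. *)

theory Defs
  imports Complex_Main
begin

text \<open>
  A Lie algebra over a field \<open>'k\<close> of characteristic zero lives on a whole type \<open>'v\<close>, as in the
  library's \<open>vector_space\<close>.  Finite dimension is part of the definition, since the library's
  \<open>dim\<close> is a junk value on infinite-dimensional spaces.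
\<close>

locale lie_algebra = vector_space scale
  for scale :: "'k::field_char_0 \<Rightarrow> 'v::ab_group_add \<Rightarrow> 'v" +
  fixes bracket :: "'v \<Rightarrow> 'v \<Rightarrow> 'v"
  assumes finite_dimensional: "\<exists>B. finite B \<and> span B = UNIV"
    and bracket_linear_right: "\<And>x. Vector_Spaces.linear scale scale (\<lambda>y. bracket x y)"
    and bracket_linear_left: "\<And>y. Vector_Spaces.linear scale scale (\<lambda>x. bracket x y)"
    and bracket_self: "\<And>x. bracket x x = 0"
    and jacobi: "\<And>x y z.
      bracket x (bracket y z) + bracket y (bracket z x) + bracket z (bracket x y) = 0"
begin

definition lie_ideal :: "'v set \<Rightarrow> bool" where
  "lie_ideal I \<longleftrightarrow> subspace I \<and> (\<forall>x. \<forall>y\<in>I. bracket x y \<in> I)"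

primrec lower_central_series :: "nat \<Rightarrow> 'v set" where
  "lower_central_series 0 = UNIV"
| "lower_central_series (Suc n) = span {bracket x y | x y. y \<in> lower_central_series n}"

definition nilpotent :: bool where
  "nilpotent \<longleftrightarrow> (\<exists>n. lower_central_series n = {0})"

end

locale symplectic_lie_algebra = lie_algebra scale bracket
  for scale :: "'k::field_char_0 \<Rightarrow> 'v::ab_group_add \<Rightarrow> 'v"
    and bracket :: "'v \<Rightarrow> 'v \<Rightarrow> 'v" +
  fixes \<omega> :: "'v \<Rightarrow> 'v \<Rightarrow> 'k"
  assumes form_linear_right: "\<And>u. Vector_Spaces.linear scale (*) (\<lambda>v. \<omega> u v)"
    and form_linear_left: "\<And>v. Vector_Spaces.linear scale (*) (\<lambda>u. \<omega> u v)"
    and form_self: "\<And>u. \<omega> u u = 0"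
    and form_nondegenerate: "\<And>u. (\<And>v. \<omega> u v = 0) \<Longrightarrow> u = 0"
    and form_closed: "\<And>u v w. \<omega> (bracket u v) w + \<omega> (bracket w u) v + \<omega> (bracket v w) u = 0"
begin

definition orthogonal :: "'v set \<Rightarrow> 'v set" where
  "orthogonal S = {v. \<forall>w\<in>S. \<omega> v w = 0}"

definition lagrangian_ideal :: "'v set \<Rightarrow> bool" where
  "lagrangian_ideal I \<longleftrightarrow> lie_ideal I \<and> orthogonal I = I"

end

end

theory Submission
  imports Defs
begin

text \<open>
  Nilpotency lets an isotropic ideal \<open>J\<close> be enlarged by one dimension inside any strictly larger
  ideal \<open>K \<subseteq> J\<^sup>\<bottom>\<close>.  Starting from \<open>0\<close> this yields a central \<open>z\<close>, and then
  \<open>v \<in> z\<^sup>\<bottom>\<close> with \<open>[\<gg>, v] \<subseteq> \<langle>z\<rangle>\<close>, because \<open>z\<^sup>\<bottom>\<close> is an ideal.  For \<open>J = \<langle>z, v\<rangle>\<close> the space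
  \<open>J\<^sup>\<bottom>\<close> need not be an ideal, but its intersection with the centralizer of \<open>v\<close> always is, and it is
  strictly larger than \<open>J\<close> unless \<open>J\<close> is Lagrangian.  Thus there is a Lagrangian ideal or an
  isotropic ideal of dimension three, which is Lagrangian when \<open>dim \<gg> \<le> 6\<close>.
\<close>

section \<open>Ideals, nilpotency and dimension\<close>

context lie_algebra
begin

lemma bracket_simps:
  "bracket x (y + y') = bracket x y + bracket x y'"
  "bracket (x + x') y = bracket x y + bracket x' y"
  "bracket x (scale c y) = scale c (bracket x y)"
  "bracket (scale c x) y = scale c (bracket x y)"
  using bracket_linear_right[of x] bracket_linear_left[of y]
  unfolding Vector_Spaces.linear_iff by blast+

lemma bracket_zero [simp]: "bracket x 0 = 0" "bracket 0 y = 0"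
  using bracket_simps(3)[of x 0 0] bracket_simps(4)[of 0 0 y] by simp_all

lemma bracket_minus [simp]: "bracket x (- y) = - bracket x y"
  using bracket_simps(3)[of x "- 1" y] by simp

lemma bracket_diff: "bracket (x - x') y = bracket x y - bracket x' y"
  by (simp only: eq_diff_eq bracket_simps(2)[symmetric] diff_add_cancel)

lemma bracket_skew: "bracket y x = - bracket x y"
proof -
  have "bracket (x + y) (x + y) = bracket y x + bracket x y"
    unfolding bracket_simps bracket_self[of x] bracket_self[of y] by simp
  then have "bracket y x + bracket x y = 0"
    using bracket_self[of "x + y"] by (rule trans[OF sym])
  then show ?thesis
    by (rule eq_neg_iff_add_eq_0[THEN iffD2])
qed

text \<open>For fixed \<open>y\<close>, the vectors that \<open>bracket y\<close> sends into
  \<open>J\<close> form a subspace containing \<open>x\<close> and \<open>J\<close>, hence the whole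
  span.\<close>

lemma span_insert_lie_ideal:
  assumes J: "lie_ideal J" and x: "\<And>y. bracket y x \<in> J"
  shows "lie_ideal (span (insert x J))"
  unfolding lie_ideal_def
proof (intro conjI allI ballI)
  fix y u assume "u \<in> span (insert x J)"
  moreover have "subspace {u. bracket y u \<in> J}"
    using J unfolding lie_ideal_def subspace_def by (simp add: bracket_simps)
  moreover have "insert x J \<subseteq> {u. bracket y u \<in> J}"
    using J x unfolding lie_ideal_def by blast
  ultimately have "bracket y u \<in> J"
    using span_minimal by blast
  then show "bracket y u \<in> span (insert x J)"
    by (simp add: span_base)
qed simp

text \<open>Intersecting \<open>K\<close> with the lower central series leads from \<open>K\<close>,
  not inside \<open>J\<close>, down to \<open>{0}\<close>. Where containment in \<open>J\<close>
  sets in, a vector of the preceding term outside \<open>J\<close> serves as \<open>x\<close>, since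
  its brackets lie in the next term.\<close>

lemma nilpotent_ideal_step:
  assumes nil: "nilpotent" and J: "lie_ideal J" and K: "lie_ideal K" and JK: "\<not> K \<subseteq> J"
  obtains x where "x \<in> K" "x \<notin> J" "\<And>y. bracket y x \<in> J"
proof -
  let ?P = "\<lambda>n. K \<inter> lower_central_series n \<subseteq> J"
  obtain n where "lower_central_series n = {0}"
    using nil unfolding nilpotent_def by blast
  with J have "?P n"
    unfolding lie_ideal_def by (auto intro: subspace_0)
  moreover have "\<not> ?P 0"
    using JK by simp
  ultimately obtain m where m: "\<not> ?P m" "?P (Suc m)"
    by (induction n) auto
  then obtain x where x: "x \<in> K" "x \<in> lower_central_series m" "x \<notin> J"
    by blast
  have "bracket y x \<in> J" for y
  proof -
    have "bracket y x \<in> lower_central_series (Suc m)"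
      using x(2) by (auto intro: span_base)
    moreover have "bracket y x \<in> K"
      using K x(1) unfolding lie_ideal_def by blast
    ultimately show ?thesis
      using m(2) by blast
  qed
  with x that show thesis by blast
qed

lemma dim_strict_mono:
  assumes "subspace S" "subspace T" "S \<subset> T"
  shows "dim S < dim T"
proof -
  obtain F where F: "finite F" "span F = UNIV"
    using finite_dimensional by blast
  obtain B where B: "B \<subseteq> F" "independent B" "F \<subseteq> span B"
    using maximal_independent_subset by blast
  then have "span B = UNIV"
    using F(2) span_minimal[OF B(3) subspace_span] by blast
  \<comment> \<open>A basis chosen inside a finite spanning set is finite, which gives access to
    \<open>dim_psubset\<close>.\<close>
  then interpret finite_dimensional_vector_space scale B
    using B F(1) by unfold_locales (auto intro: finite_subset)
  show ?thesis
    using assms dim_psubset[of S T] unfolding span_eq_iff[THEN iffD2, OF assms(1)]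
      span_eq_iff[THEN iffD2, OF assms(2)] by blast
qed

lemma subspace_finite_span:
  assumes "subspace S"
  obtains F where "finite F" "span F = S"
proof -
  obtain E where E: "finite E" "span E = UNIV"
    using finite_dimensional by blast
  obtain F where F: "F \<subseteq> S" "independent F" "S \<subseteq> span F"
    using maximal_independent_subset by blast
  have "finite F"
    using independent_span_bound[OF E(1) F(2)] E(2) by simp
  moreover have "span F = S"
    using F(3) span_minimal[OF F(1) assms] by blast
  ultimately show thesis
    using that by blast
qed

end

section \<open>The symplectic form and double orthogonal complements\<close>

context symplectic_lie_algebra
begin

lemma form_simps:
  "\<omega> x (y + y') = \<omega> x y + \<omega> x y'"
  "\<omega> (x + x') y = \<omega> x y + \<omega> x' y"
  "\<omega> x (scale c y) = c * \<omega> x y"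
  "\<omega> (scale c x) y = c * \<omega> x y"
  using form_linear_right[of x] form_linear_left[of y]
  unfolding Vector_Spaces.linear_iff by blast+

lemma form_zero [simp]: "\<omega> x 0 = 0" "\<omega> 0 y = 0"
  using form_simps(3)[of x 0 0] form_simps(4)[of 0 0 y] by simp_all

lemma form_diff: "\<omega> x (y - y') = \<omega> x y - \<omega> x y'" "\<omega> (x - x') y = \<omega> x y - \<omega> x' y"
  by (simp_all only: eq_diff_eq form_simps(1,2)[symmetric] diff_add_cancel)

lemma form_skew: "\<omega> y x = - \<omega> x y"
proof -
  have "\<omega> (x + y) (x + y) = \<omega> y x + \<omega> x y"
    unfolding form_simps form_self[of x] form_self[of y] by simp
  then have "\<omega> y x + \<omega> x y = 0"
    using form_self[of "x + y"] by (rule trans[OF sym])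
  then show ?thesis
    by (rule eq_neg_iff_add_eq_0[THEN iffD2])
qed

lemma form_eq_0_commute: "\<omega> x y = 0 \<longleftrightarrow> \<omega> y x = 0"
  using form_skew[of x y] by simp

lemma subspace_orthogonal: "subspace (orthogonal S)"
  unfolding subspace_def orthogonal_def by (simp add: form_simps)

lemma orthogonal_antimono: "S \<subseteq> T \<Longrightarrow> orthogonal T \<subseteq> orthogonal S"
  unfolding orthogonal_def by blast

lemma orthogonal_span: "orthogonal (span S) = orthogonal S"
proof
  show "orthogonal (span S) \<subseteq> orthogonal S"
    by (simp add: orthogonal_antimono span_superset)
  show "orthogonal S \<subseteq> orthogonal (span S)"
  proof
    fix v assume "v \<in> orthogonal S"
    then have "S \<subseteq> {w. \<omega> v w = 0}"
      unfolding orthogonal_def by blast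
    moreover have "subspace {w. \<omega> v w = 0}"
      unfolding subspace_def by (simp add: form_simps)
    ultimately show "v \<in> orthogonal (span S)"
      using span_minimal unfolding orthogonal_def by blast
  qed
qed

text \<open>Induction on \<open>F\<close>: subtracting a suitable multiple of
  \<open>\<omega> s\<close> from \<open>f\<close> reduces to the remaining vectors. The lemma serves
  to compute double complements.\<close>

lemma functional_vanishing_on_orthogonal:
  assumes "finite F"
    and "\<And>x y. f (x + y) = f x + f y" and "\<And>c x. f (scale c x) = c * f x"
    and "\<And>x. x \<in> orthogonal F \<Longrightarrow> f x = 0"
  shows "\<exists>u\<in>span F. \<forall>x. f x = \<omega> u x"
  using assms
proof (induction F arbitrary: f rule: finite_induct)
  case empty
  then show ?case by (simp add: orthogonal_def)
next
  case (insert s F)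
  have diff: "f (x - y) = f x - f y" for x y
    using insert.prems(1)[of "x - y" y] by simp
  show ?case
  proof (cases "\<forall>y\<in>orthogonal F. \<omega> s y = 0")
    case True
    \<comment> \<open>Here \<open>s\<close> imposes no new condition, so the induction hypothesis
      applies to \<open>f\<close> itself.\<close>
    then have "orthogonal F \<subseteq> orthogonal (insert s F)"
      using form_eq_0_commute unfolding orthogonal_def by blast
    then obtain u where "u \<in> span F" "\<forall>x. f x = \<omega> u x"
      using insert.IH[of f] insert.prems by blast
    then show ?thesis
      using span_mono[of F "insert s F"] by blast
  next
    case False
    then obtain y where y: "y \<in> orthogonal F" "\<omega> s y \<noteq> 0" by blast
    \<comment> \<open>This value makes \<open>f - c * \<omega> s\<close> vanish at
      \<open>y\<close>.\<close>
    define c where "c = f y / \<omega> s y"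
    have "\<exists>u\<in>span F. \<forall>x. f x - c * \<omega> s x = \<omega> u x"
    proof (rule insert.IH)
      fix x assume x: "x \<in> orthogonal F"
      \<comment> \<open>Correcting by a multiple of \<open>y\<close> moves \<open>x\<close> into the
        kernel of \<open>\<omega> s\<close> without leaving \<open>orthogonal F\<close>.\<close>
      define t where "t = x - scale (\<omega> s x / \<omega> s y) y"
      have "t \<in> orthogonal F"
        unfolding t_def using x y(1) by (intro subspace_diff subspace_scale subspace_orthogonal)
      moreover have "\<omega> s t = 0"
        using y(2) by (simp add: t_def form_diff form_simps)
      then have "\<omega> t s = 0"
        using form_skew[of t s] by simp
      ultimately have "f t = 0"
        by (intro insert.prems) (simp add: orthogonal_def)
      then show "f x - c * \<omega> s x = 0"
        by (simp add: t_def c_def diff insert.prems)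
    qed (simp_all add: insert.prems form_simps algebra_simps)
    then obtain u where u: "u \<in> span F" "\<forall>x. f x - c * \<omega> s x = \<omega> u x" by blast
    have "u + scale c s \<in> span (insert s F)"
      using u(1) span_mono[of F "insert s F"]
      by (intro span_add span_scale) (auto intro: span_base)
    moreover have "f x = \<omega> (u + scale c s) x" for x
      using u(2)[rule_format, of x] by (simp add: form_simps algebra_simps)
    ultimately show ?thesis by blast
  qed
qed

text \<open>For \<open>t\<close> in the double complement, \<open>\<omega> t\<close> kills
  \<open>orthogonal S\<close>, so it equals \<open>\<omega> u\<close> for some \<open>u\<close> in
  \<open>S\<close>; nondegeneracy gives \<open>t = u\<close>.\<close>

lemma orthogonal_orthogonal:
  assumes "subspace S"
  shows "orthogonal (orthogonal S) = S"
proof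
  show "S \<subseteq> orthogonal (orthogonal S)"
    using form_eq_0_commute unfolding orthogonal_def by blast
  show "orthogonal (orthogonal S) \<subseteq> S"
  proof
    fix t assume t: "t \<in> orthogonal (orthogonal S)"
    obtain F where F: "finite F" "span F = S"
      using assms by (rule subspace_finite_span)
    obtain u where u: "u \<in> span F" "\<forall>x. \<omega> t x = \<omega> u x"
    proof -
      have "\<omega> t x = 0" if "x \<in> orthogonal F" for x
        using that t F(2) orthogonal_span[of F] unfolding orthogonal_def by blast
      then show thesis
        using functional_vanishing_on_orthogonal[of F "\<omega> t"] F(1) that
        by (auto simp: form_simps)
    qed
    then have "t - u = 0"
      by (intro form_nondegenerate) (simp add: form_diff)
    with u(1) F(2) show "t \<in> S" by simp
  qed
qed

lemma orthogonal_strict_antimono: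
  assumes "subspace S" "subspace T" "S \<subset> T"
  shows "orthogonal T \<subset> orthogonal S"
proof (rule psubsetI)
  show "orthogonal T \<subseteq> orthogonal S"
    using assms(3) by (intro orthogonal_antimono) blast
  show "orthogonal T \<noteq> orthogonal S"
    using assms(3) orthogonal_orthogonal[OF assms(1)] orthogonal_orthogonal[OF assms(2)] by auto
qed

section \<open>Enlarging isotropic ideals\<close>

definition isotropic_ideal :: "'v set \<Rightarrow> bool" where
  "isotropic_ideal J \<longleftrightarrow> lie_ideal J \<and> J \<subseteq> orthogonal J"

text \<open>Choosing \<open>x\<close> inside \<open>K \<subseteq> orthogonal J\<close> keeps the
  span isotropic. The bracket condition is kept in the conclusion because it makes \<open>z\<close>
  central and puts the brackets with \<open>v\<close> into \<open>span {z}\<close>.\<close>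

lemma isotropic_ideal_step:
  assumes nil: "nilpotent" and J: "isotropic_ideal J" and K: "lie_ideal K"
    and sub: "K \<subseteq> orthogonal J" "\<not> K \<subseteq> J"
  obtains x where "x \<notin> J" "\<And>y. bracket y x \<in> J" "isotropic_ideal (span (insert x J))"
proof -
  have J': "lie_ideal J" "J \<subseteq> orthogonal J"
    using J unfolding isotropic_ideal_def by auto
  obtain x where x: "x \<in> K" "x \<notin> J" "\<And>y. bracket y x \<in> J"
    using nilpotent_ideal_step[OF nil J'(1) K sub(2)] by blast
  have "\<omega> x w = 0" "\<omega> w x = 0" if "w \<in> J" for w
    using that x(1) sub(1) form_eq_0_commute[of w x] unfolding orthogonal_def by blast+
  then have "insert x J \<subseteq> orthogonal (insert x J)"
    using J'(2) unfolding orthogonal_def by (auto simp: form_self)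
  then have "span (insert x J) \<subseteq> orthogonal (span (insert x J))"
    unfolding orthogonal_span by (rule span_minimal[OF _ subspace_orthogonal])
  then have "isotropic_ideal (span (insert x J))"
    using span_insert_lie_ideal[OF J'(1) x(3)] unfolding isotropic_ideal_def by blast
  with x that show thesis by blast
qed

text \<open>For central \<open>z\<close> two terms of the closedness identity vanish, so every
  bracket is orthogonal to \<open>z\<close>.\<close>

lemma lie_ideal_orthogonal_central:
  assumes "\<And>y. bracket y z = 0"
  shows "lie_ideal (orthogonal {z})"
  unfolding lie_ideal_def
proof (intro conjI allI ballI)
  fix u x
  show "bracket u x \<in> orthogonal {z}"
    using form_closed[of u x z] assms bracket_skew[of z u] by (simp add: orthogonal_def)
qed (rule subspace_orthogonal)

text \<open>
  For \<open>u \<in> \<gg>\<close> and \<open>x\<close> in the ideal, closedness reads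
  \<open>\<omega>([u,x],v) = - \<omega>([v,u],x) - \<omega>([x,v],u)\<close>, where \<open>[v,u] \<in> \<langle>z\<rangle>\<close> is orthogonal to \<open>x\<close> and \<open>[x,v] = 0\<close>.
\<close>

lemma lie_ideal_orthogonal_centralizer:
  assumes z: "\<And>y. bracket y z = 0" and v: "\<And>y. bracket y v \<in> span {z}"
  shows "lie_ideal (orthogonal {z, v} \<inter> {x. bracket x v = 0})"
  unfolding lie_ideal_def
proof (intro conjI allI ballI)
  have "subspace {x. bracket x v = 0}"
    unfolding subspace_def by (simp add: bracket_simps)
  then show "subspace (orthogonal {z, v} \<inter> {x. bracket x v = 0})"
    by (intro subspace_inter subspace_orthogonal)
  fix u x assume "x \<in> orthogonal {z, v} \<inter> {x. bracket x v = 0}"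
  then have x: "\<omega> x z = 0" "bracket x v = 0"
    unfolding orthogonal_def by auto
  obtain c where c: "bracket u v = scale c z"
    using v[of u] unfolding span_singleton by blast
  then have vu: "bracket v u = scale (- c) z"
    using bracket_skew[of v u] by simp
  have "\<omega> (bracket u x) z = 0"
    using lie_ideal_orthogonal_central[OF z] x(1) by (simp add: lie_ideal_def orthogonal_def)
  moreover have "\<omega> (bracket u x) v = 0"
  proof -
    have "\<omega> (bracket v u) x = 0"
      using x(1) form_eq_0_commute[of z x] unfolding vu form_simps by simp
    then show ?thesis
      using form_closed[of u x v] x(2) by simp
  qed
  \<comment> \<open>In the Jacobi identity \<open>bracket x v\<close> is zero and
    \<open>bracket v u\<close> is a multiple of the central \<open>z\<close>.\<close>
  moreover have "bracket (bracket u x) v = 0"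
    using jacobi[of u x v] x(2) vu z bracket_skew[of "bracket u x" v] by (simp add: bracket_simps)
  ultimately show "bracket u x \<in> orthogonal {z, v} \<inter> {x. bracket x v = 0}"
    by (simp add: orthogonal_def)
qed

text \<open>On the complement of \<open>span {z, v}\<close>, bracketing with \<open>v\<close> takes
  values in a line, so its kernel has codimension at most one. Were the kernel inside the span, the
  complement would be spanned by it and one vector \<open>y\<close>, making \<open>y\<close>
  orthogonal to the whole complement and hence a member of the span.\<close>

lemma orthogonal_centralizer_not_subset:
  assumes v: "\<And>y. bracket y v \<in> span {z}"
    and iso: "span {z, v} \<subset> orthogonal {z, v}"
  shows "\<not> orthogonal {z, v} \<inter> {x. bracket x v = 0} \<subseteq> span {z, v}"
proof
  let ?J = "span {z, v}"
  assume sub: "orthogonal {z, v} \<inter> {x. bracket x v = 0} \<subseteq> ?J"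
  then obtain y where y: "y \<in> orthogonal {z, v}" "y \<notin> ?J" "bracket y v \<noteq> 0"
    using iso by blast
  obtain c where c: "bracket y v = scale c z"
    using v[of y] unfolding span_singleton by blast
  with y(3) have "c \<noteq> 0" by auto
  have "\<omega> y x = 0" if x: "x \<in> orthogonal {z, v}" for x
  proof -
    obtain d where d: "bracket x v = scale d z"
      using v[of x] unfolding span_singleton by blast
    define t where "t = x - scale (d / c) y"
    have "t \<in> orthogonal {z, v}"
      unfolding t_def using x y(1) by (intro subspace_diff subspace_scale subspace_orthogonal)
    moreover have "bracket t v = 0"
      using \<open>c \<noteq> 0\<close> c d by (simp add: t_def bracket_diff bracket_simps)
    ultimately have "t \<in> ?J"
      using sub by blast
    then have "\<omega> y t = 0"
      using y(1) orthogonal_span[of "{z, v}"] unfolding orthogonal_def by blast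
    then show ?thesis
      by (simp add: t_def form_diff form_simps form_self)
  qed
  then have "y \<in> orthogonal (orthogonal ?J)"
    unfolding orthogonal_span by (simp add: orthogonal_def)
  with y(2) show False
    using orthogonal_orthogonal[OF subspace_span] by blast
qed

section \<open>Lagrangian ideals and the dimension count\<close>

lemma lagrangian_ideal_iff: "lagrangian_ideal J \<longleftrightarrow> isotropic_ideal J \<and> \<not> J \<subset> orthogonal J"
  unfolding lagrangian_ideal_def isotropic_ideal_def by blast

lemma span_insert_strict: "subspace J \<Longrightarrow> x \<notin> J \<Longrightarrow> J \<subset> span (insert x J)"
  using span_superset[of "insert x J"] by blast

lemma span_insert_of_span: "span (insert x (span S)) = span (insert x S)"
proof (rule span_eq[THEN iffD2], rule conjI)
  have "span S \<subseteq> span (insert x S)"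
    by (rule span_mono) blast
  then show "insert x (span S) \<subseteq> span (insert x S)"
    by (simp add: span_base)
  show "insert x S \<subseteq> span (insert x (span S))"
    using span_superset[of S] by (auto intro: span_base)
qed

lemma exists_lagrangian_ideal:
  assumes nil: "nilpotent" and dim: "dim UNIV \<le> 6"
  shows "\<exists>I. lagrangian_ideal I"
proof (rule ccontr)
  assume "\<nexists>I. lagrangian_ideal I"
  then have strict: "J \<subset> orthogonal J" if "isotropic_ideal J" for J
    using that lagrangian_ideal_iff by blast
  have J0: "isotropic_ideal {0}"
    by (simp add: isotropic_ideal_def lie_ideal_def orthogonal_def)
  have UNIV_ideal: "lie_ideal UNIV"
    by (simp add: lie_ideal_def)
  have orth0: "orthogonal {0} = UNIV"
    by (simp add: orthogonal_def)
  obtain z where z: "z \<notin> {0}" "\<And>y. bracket y z \<in> {0}" "isotropic_ideal (span (insert z {0}))"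
  proof (rule isotropic_ideal_step[OF nil J0 UNIV_ideal])
    \<comment> \<open>The zero algebra is excluded because there \<open>{0}\<close> would itself be
      Lagrangian.\<close>
    show "UNIV \<subseteq> orthogonal {0}" "\<not> UNIV \<subseteq> {0 :: 'v}"
      using strict[OF J0] unfolding orth0 by auto
  qed (rule that)
  define J1 where "J1 = span {z}"
  have span_z: "span (insert z {0}) = J1"
    unfolding J1_def by (metis insert_commute span_insert_0)
  have J1: "isotropic_ideal J1" "{0} \<subset> J1"
    using z(3) span_insert_strict[OF _ z(1)] unfolding span_z by simp_all
  have zc: "bracket y z = 0" for y
    using z(2)[of y] by simp
  have orth1: "orthogonal J1 = orthogonal {z}"
    by (simp add: J1_def orthogonal_span)
  obtain v where v: "v \<notin> J1" "\<And>y. bracket y v \<in> J1" "isotropic_ideal (span (insert v J1))"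
  proof (rule isotropic_ideal_step[OF nil J1(1) lie_ideal_orthogonal_central[OF zc]])
    show "orthogonal {z} \<subseteq> orthogonal J1" "\<not> orthogonal {z} \<subseteq> J1"
      using strict[OF J1(1)] unfolding orth1 by auto
  qed (rule that)
  define J2 where "J2 = span {z, v}"
  have span_v: "span (insert v J1) = J2"
    using span_insert_of_span[of v "{z}"] unfolding J1_def J2_def by (simp add: insert_commute)
  have J2: "isotropic_ideal J2" "J1 \<subset> J2"
    using v(3) span_insert_strict[OF _ v(1)] unfolding span_v by (simp_all add: J1_def)
  have orth2: "orthogonal J2 = orthogonal {z, v}"
    by (simp add: J2_def orthogonal_span)
  have vb: "bracket y v \<in> span {z}" for y
    using v(2) J1_def by simp
  obtain x where x: "x \<notin> J2" "isotropic_ideal (span (insert x J2))"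
  proof (rule isotropic_ideal_step[OF nil J2(1) lie_ideal_orthogonal_centralizer[OF zc vb]])
    show "orthogonal {z, v} \<inter> {x. bracket x v = 0} \<subseteq> orthogonal J2"
      using orth2 by blast
    show "\<not> orthogonal {z, v} \<inter> {x. bracket x v = 0} \<subseteq> J2"
      using orthogonal_centralizer_not_subset[OF vb] strict[OF J2(1)] orth2
      unfolding J2_def by simp
  qed (rule that)
  define J3 where "J3 = span (insert x J2)"
  have J3: "isotropic_ideal J3" "J2 \<subset> J3"
    using x(2) span_insert_strict[OF _ x(1)] unfolding J3_def by (simp_all add: J2_def)
  have sub: "subspace J1" "subspace J2" "subspace J3" "subspace {0}"
    by (simp_all add: J1_def J2_def J3_def)
  \<comment> \<open>Three enlargements, the strict inclusion of \<open>J3\<close> in its complement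
    and three dual inclusions give seven strict steps from \<open>{0}\<close> to
    \<open>UNIV\<close>, forcing dimension at least 7.\<close>
  note chain = J1(2) J2(2) J3(2) strict[OF J3(1)]
    orthogonal_strict_antimono[OF sub(2,3) J3(2)]
    orthogonal_strict_antimono[OF sub(1,2) J2(2)]
    orthogonal_strict_antimono[OF sub(4,1) J1(2)]
  have "dim {0} < dim J1" "dim J1 < dim J2" "dim J2 < dim J3" "dim J3 < dim (orthogonal J3)"
    "dim (orthogonal J3) < dim (orthogonal J2)" "dim (orthogonal J2) < dim (orthogonal J1)"
    "dim (orthogonal J1) < dim (orthogonal {0})"
    by (rule dim_strict_mono; intro sub subspace_orthogonal chain)+
  with dim orth0 show False by simp
qed

end

theorem theorem8p4:
  fixes scale :: "'k::field_char_0 \<Rightarrow> 'v::ab_group_add \<Rightarrow> 'v"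
    and bracket :: "'v \<Rightarrow> 'v \<Rightarrow> 'v"
    and \<omega> :: "'v \<Rightarrow> 'v \<Rightarrow> 'k"
  assumes "symplectic_lie_algebra scale bracket \<omega>"
    and "lie_algebra.nilpotent scale bracket"
    and "vector_space.dim scale (UNIV :: 'v set) \<le> 6"
  shows "\<exists>I. symplectic_lie_algebra.lagrangian_ideal scale bracket \<omega> I"
  using symplectic_lie_algebra.exists_lagrangian_ideal[OF assms] .

end
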